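(* Let $k>0$ and let $\xi,\xi',\xi_0$ be real numbers satisfying $0<\xi<\xi_0$ and $0<\xi'<\xi_0$. For $\eta,\eta'\in\mathbb{R}$ set $$\mathcal{I}(\xi,\eta,\xi',\eta')=\int_{-\pi}^{\pi}u_k(\xi,\eta,\xi_0,\eta'')\,\partial_3v_k(\xi',\eta',\xi_0,\eta'')\,d\eta''.$$ Then $\mathcal{I}$ is symmetric in $(\xi,\eta)$ and $(\xi',\eta')$; that is, $\mathcal{I}(\xi,\eta,\xi',\eta')=\mathcal{I}(\xi',\eta',\xi,\eta)$ for all $\eta,\eta'\in\mathbb{R}$.
   Context: $J_0$ and $Y_0$ are the Bessel functions of the first and second kind of order $0$. Elliptical coordinates: for $(\xi,\eta)\in\mathbb{R}^2$, $x(\xi,\eta)=(\cosh\xi\cos\eta,\ \sinh\xi\sin\eta)\in\mathbb{R}^2$. For $k>0$, $$u_k(\xi,\eta,\xi',\eta')=J_0\big(k|x(\xi,\eta)-x(\xi',\eta')|\big),\qquad v_k(\xi,\eta,\xi',\eta')=Y_0\big(k|x(\xi,\eta)-x(\xi',\eta')|\big),$$ where $|\cdot|$ is the Euclidean norm, and $\partial_3$ denotes the partial derivative with respect to the third of the four arguments. *)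

theory Defs
  imports "HOL-Analysis.Analysis"
begin

definition bessel_J0 :: "real \<Rightarrow> real" where
  "bessel_J0 z = (\<Sum>m. (- 1) ^ m * (z\<^sup>2 / 4) ^ m / (fact m)\<^sup>2)"

text \<open>The standard series (DLMF 10.8.2) for the function of the second kind, for \<open>z > 0\<close>.
  As \<open>harm 0 = 0\<close>, the sum effectively starts at \<open>m = 1\<close>.
  Only the values at \<open>z > 0\<close> are meaningful.\<close>

definition bessel_Y0 :: "real \<Rightarrow> real" where
  "bessel_Y0 z = 2 / pi * (ln (z / 2) + euler_mascheroni) * bessel_J0 z
     + 2 / pi * (\<Sum>m. (- 1) ^ (m + 1) * harm m * (z\<^sup>2 / 4) ^ m / (fact m)\<^sup>2)"

text \<open>The norm, hence \<open>dist\<close>, on \<^typ>\<open>real \<times> real\<close> is the Euclidean one.\<close>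

definition elliptic :: "real \<Rightarrow> real \<Rightarrow> real \<times> real" where
  "elliptic \<xi> \<eta> = (cosh \<xi> * cos \<eta>, sinh \<xi> * sin \<eta>)"

definition u_fun :: "real \<Rightarrow> real \<Rightarrow> real \<Rightarrow> real \<Rightarrow> real \<Rightarrow> real" where
  "u_fun k \<xi> \<eta> \<xi>' \<eta>' = bessel_J0 (k * dist (elliptic \<xi> \<eta>) (elliptic \<xi>' \<eta>'))"

definition v_fun :: "real \<Rightarrow> real \<Rightarrow> real \<Rightarrow> real \<Rightarrow> real \<Rightarrow> real" where
  "v_fun k \<xi> \<eta> \<xi>' \<eta>' = bessel_Y0 (k * dist (elliptic \<xi> \<eta>) (elliptic \<xi>' \<eta>'))"

definition d3v :: "real \<Rightarrow> real \<Rightarrow> real \<Rightarrow> real \<Rightarrow> real \<Rightarrow> real" where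
  "d3v k \<xi> \<eta> \<xi>' \<eta>' = deriv (\<lambda>s. v_fun k \<xi> \<eta> s \<eta>') \<xi>'"

definition I_int :: "real \<Rightarrow> real \<Rightarrow> real \<Rightarrow> real \<Rightarrow> real \<Rightarrow> real \<Rightarrow> real" where
  "I_int k \<xi>0 \<xi> \<eta> \<xi>' \<eta>' = integral {- pi..pi} (\<lambda>\<eta>''. u_fun k \<xi> \<eta> \<xi>0 \<eta>'' * d3v k \<xi>' \<eta>' \<xi>0 \<eta>'')"

end

theory Submission
  imports Defs
begin

text \<open>In elliptic coordinates the squared distance factors as
  \<open>(cosh (\<xi> + \<xi>') - cos (\<eta> + \<eta>')) (cosh (\<xi> - \<xi>') - cos (\<eta> - \<eta>'))\<close>. Hence a function \<open>U\<close> of the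
  distance solving Bessel's equation satisfies, with \<open>t\<close> the angle of the second point,
  \<open>U\<^sub>\<eta>\<^sub>\<eta> = U\<^sub>t\<^sub>t + k\<^sup>2/2 (cos 2\<eta> - cos 2t) U\<close> and \<open>U\<^sub>\<xi>\<^sub>\<xi> = - U\<^sub>t\<^sub>t - k\<^sup>2/2 (cosh 2\<xi> - cos 2t) U\<close>.
  Integrating by parts in \<open>t\<close>, the integral over \<open>t\<close> of \<open>u\<close> (radius \<open>\<xi>\<^sub>0\<close>) times \<open>v\<close> (radius \<open>s\<close>)
  solves a hyperbolic equation \<open>G\<^sub>x\<^sub>x - G\<^sub>y\<^sub>y = (\<phi> x - \<phi> y) G\<close>, both in \<open>(x, y) = (\<xi>, \<xi>')\<close> and in
  \<open>(x, y) = (\<eta>, \<eta>')\<close>. A solution that vanishes on both characteristics \<open>x = y\<close> and \<open>x = -y\<close> is zero.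
  Applied to the antisymmetric part of the integral, first in \<open>(\<xi>, \<xi>')\<close> with \<open>\<eta> = \<eta>'\<close> and then in
  \<open>(\<eta>, \<eta>')\<close>, where the reflections of the ellipse give the vanishing on \<open>x = -y\<close>, this yields the
  symmetry for every \<open>s\<close>; differentiating in \<open>s\<close> at \<open>\<xi>\<^sub>0\<close> gives the theorem.\<close>

section \<open>Bessel functions in the variable \<open>z\<^sup>2 / 4\<close>\<close>

text \<open>In \<open>t f'' + f' + f\<close> the first two terms give
  \<open>n (n + 1) + (n + 1) = (n + 1)\<^sup>2\<close> times \<open>c (Suc n)\<close>, so the Bessel
  operator becomes a two-term recurrence on coefficients.\<close>

lemma power_series_bessel_operator:
  fixes c :: "nat \<Rightarrow> real"
  assumes summ: "\<And>y. summable (\<lambda>n. c n * y ^ n)"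
  shows "((\<lambda>t. \<Sum>n. c n * t ^ n) has_real_derivative (\<Sum>n. diffs c n * t ^ n)) (at t)"
    and "((\<lambda>t. \<Sum>n. diffs c n * t ^ n) has_real_derivative (\<Sum>n. diffs (diffs c) n * t ^ n)) (at t)"
    and "t * (\<Sum>n. diffs (diffs c) n * t ^ n) + (\<Sum>n. diffs c n * t ^ n) + (\<Sum>n. c n * t ^ n)
         = (\<Sum>n. ((real n + 1)\<^sup>2 * c (Suc n) + c n) * t ^ n)"
proof -
  have summ1: "summable (\<lambda>n. diffs c n * y ^ n)" for y
    using termdiff_converges_all summ by blast
  have summ2: "summable (\<lambda>n. diffs (diffs c) n * y ^ n)" for y
    using termdiff_converges_all summ1 by blast
  show "((\<lambda>t. \<Sum>n. c n * t ^ n) has_real_derivative (\<Sum>n. diffs c n * t ^ n)) (at t)"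
    by (rule termdiffs_strong_converges_everywhere[OF summ])
  show "((\<lambda>t. \<Sum>n. diffs c n * t ^ n) has_real_derivative (\<Sum>n. diffs (diffs c) n * t ^ n)) (at t)"
    by (rule termdiffs_strong_converges_everywhere[OF summ1])
  have "(\<lambda>n. t * (diffs (diffs c) n * t ^ n)) sums (t * (\<Sum>n. diffs (diffs c) n * t ^ n))"
    by (intro sums_mult summable_sums summ2)
  then have "(\<lambda>n. real (Suc n) * diffs c (Suc n) * t ^ Suc n) sums (t * (\<Sum>n. diffs (diffs c) n * t ^ n))"
    by (simp add: diffs_def algebra_simps)
  then have "(\<lambda>n. real n * diffs c n * t ^ n) sums (t * (\<Sum>n. diffs (diffs c) n * t ^ n))"
    using sums_Suc_iff[of "\<lambda>n. real n * diffs c n * t ^ n"] by simp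
  from sums_add[OF sums_add[OF this summable_sums[OF summ1[of t]]] summable_sums[OF summ[of t]]]
  have "(\<lambda>n. ((real n + 1)\<^sup>2 * c (Suc n) + c n) * t ^ n) sums
      (t * (\<Sum>n. diffs (diffs c) n * t ^ n) + (\<Sum>n. diffs c n * t ^ n) + (\<Sum>n. c n * t ^ n))"
    by (simp add: diffs_def algebra_simps power2_eq_square)
  then show "t * (\<Sum>n. diffs (diffs c) n * t ^ n) + (\<Sum>n. diffs c n * t ^ n) + (\<Sum>n. c n * t ^ n)
         = (\<Sum>n. ((real n + 1)\<^sup>2 * c (Suc n) + c n) * t ^ n)"
    by (simp add: sums_iff)
qed

definition J_coeff :: "nat \<Rightarrow> real" where
  "J_coeff m = (- 1) ^ m / (fact m)\<^sup>2"

definition Y_coeff :: "nat \<Rightarrow> real" where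
  "Y_coeff m = (- 1) ^ (m + 1) * harm m / (fact m)\<^sup>2"

lemma summable_J_coeff: "summable (\<lambda>m. J_coeff m * y ^ m)"
proof (rule summable_comparison_test')
  show "summable (\<lambda>m. \<bar>y\<bar> ^ m /\<^sub>R fact m)"
    by (rule summable_exp_generic)
  show "norm (J_coeff m * y ^ m) \<le> \<bar>y\<bar> ^ m /\<^sub>R fact m" if "m \<ge> 0" for m
  proof -
    have "1 * \<bar>y\<bar> ^ m \<le> fact m * \<bar>y\<bar> ^ m"
      by (intro mult_right_mono) auto
    then show ?thesis
      by (simp add: J_coeff_def abs_mult power_abs power2_eq_square field_simps)
  qed
qed

text \<open>\<open>harm m \<le> fact m\<close> cancels one of the two factorials, and the
  exponential series dominates.\<close>

lemma summable_Y_coeff: "summable (\<lambda>m. Y_coeff m * y ^ m)"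
proof (rule summable_comparison_test')
  show "summable (\<lambda>m. \<bar>y\<bar> ^ m /\<^sub>R fact m)"
    by (rule summable_exp_generic)
  show "norm (Y_coeff m * y ^ m) \<le> \<bar>y\<bar> ^ m /\<^sub>R fact m" if "m \<ge> 0" for m
  proof -
    have "harm m \<le> (fact m :: real)"
    proof (induction m)
      case (Suc n)
      show ?case
      proof (cases n)
        case Suc': (Suc k)
        have "harm (Suc n) \<le> fact n + inverse (real (Suc n))"
          using Suc.IH by (simp add: harm_Suc)
        also have "inverse (real (Suc n)) \<le> 1"
          by (simp add: field_simps)
        \<comment> \<open>This bounds \<open>fact n + 1\<close> by \<open>fact (Suc n)\<close>; it
          fails at \<open>n = 0\<close>, hence the separate case.\<close>
        also have "1 \<le> real n * fact n"
          using Suc' mult_mono[of 1 "real n" 1 "fact n"] by (simp del: fact_Suc)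
        finally show ?thesis by (simp add: algebra_simps)
      qed (simp add: harm_expand)
    qed (simp add: harm_def)
    then have "harm m * \<bar>y\<bar> ^ m / (fact m)\<^sup>2 \<le> fact m * \<bar>y\<bar> ^ m / (fact m)\<^sup>2"
      by (intro divide_right_mono mult_right_mono) auto
    then show ?thesis
      using harm_nonneg[of m, where 'a = real]
      by (simp add: Y_coeff_def abs_mult power_abs power2_eq_square field_simps)
  qed
qed

text \<open>With \<open>t = z\<^sup>2 / 4\<close> as variable, only the squared distance enters,
  which is smooth and free of square roots.\<close>

definition J_red :: "real \<Rightarrow> real" where
  "J_red t = (\<Sum>m. J_coeff m * t ^ m)"

definition Y_red :: "real \<Rightarrow> real" where
  "Y_red t = 2 / pi * (ln t / 2 + euler_mascheroni) * J_red t + 2 / pi * (\<Sum>m. Y_coeff m * t ^ m)"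

lemma bessel_J0_eq: "bessel_J0 z = J_red (z\<^sup>2 / 4)"
  by (simp add: bessel_J0_def J_red_def J_coeff_def)

lemma bessel_Y0_eq:
  assumes "z > 0"
  shows "bessel_Y0 z = Y_red (z\<^sup>2 / 4)"
proof -
  have "ln (z / 2) = ln (z\<^sup>2 / 4) / 2"
    using assms ln_realpow[of "z / 2" 2] by (simp add: power_divide)
  then show ?thesis
    by (simp add: bessel_Y0_def Y_red_def Y_coeff_def bessel_J0_eq)
qed

text \<open>Bessel's equation of order \<open>0\<close> in the variable \<open>t = z\<^sup>2 / 4\<close>, i.e. \<open>t f'' + f' + f = 0\<close>.\<close>

definition bessel_solution :: "(real \<Rightarrow> real) \<Rightarrow> (real \<Rightarrow> real) \<Rightarrow> bool" where
  "bessel_solution f f' \<longleftrightarrow> (\<forall>t>0. (f has_real_derivative f' t) (at t) \<and>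
     (f' has_real_derivative - (f t + f' t) / t) (at t))"

text \<open>The recurrence annihilates the coefficients of \<open>J_red\<close>. Applied to
  \<open>L t * J_red t\<close> with \<open>L' = 1 / t\<close>, the Bessel operator leaves
  \<open>2 * j1 t\<close>, because \<open>t L'' + L' = 0\<close>; the series with harmonic numbers
  contributes \<open>- 2 * j1 t\<close>.\<close>

lemma bessel_solution_J_red: "\<exists>f'. bessel_solution J_red f'"
  and bessel_solution_Y_red: "\<exists>f'. bessel_solution Y_red f'"
proof -
  define j1 where "j1 t = (\<Sum>n. diffs J_coeff n * t ^ n)" for t
  define j2 where "j2 t = (\<Sum>n. diffs (diffs J_coeff) n * t ^ n)" for t
  define h where "h t = (\<Sum>n. Y_coeff n * t ^ n)" for t
  define h1 where "h1 t = (\<Sum>n. diffs Y_coeff n * t ^ n)" for t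
  define h2 where "h2 t = (\<Sum>n. diffs (diffs Y_coeff) n * t ^ n)" for t
  have J: "(J_red has_real_derivative j1 t) (at t)" "(j1 has_real_derivative j2 t) (at t)"
    "t * j2 t + j1 t + J_red t = 0" for t
  proof -
    have "(real n + 1)\<^sup>2 * J_coeff (Suc n) + J_coeff n = 0" for n
      by (simp add: J_coeff_def power2_eq_square divide_simps) (simp add: algebra_simps)
    then show "(J_red has_real_derivative j1 t) (at t)" "(j1 has_real_derivative j2 t) (at t)"
      "t * j2 t + j1 t + J_red t = 0"
      using power_series_bessel_operator[OF summable_J_coeff, of t]
      unfolding J_red_def[abs_def] j1_def[abs_def] j2_def[abs_def] by simp_all
  qed
  have Y: "(h has_real_derivative h1 t) (at t)" "(h1 has_real_derivative h2 t) (at t)"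
    "t * h2 t + h1 t + h t = - j1 t" for t
  proof -
    \<comment> \<open>Only the increment \<open>harm (Suc n) - harm n = 1 / (n + 1)\<close>
      survives.\<close>
    have "(real n + 1)\<^sup>2 * Y_coeff (Suc n) + Y_coeff n = - diffs J_coeff n" for n
      by (simp add: J_coeff_def Y_coeff_def diffs_def harm_Suc power2_eq_square divide_simps)
        (simp add: algebra_simps)
    then show "(h has_real_derivative h1 t) (at t)" "(h1 has_real_derivative h2 t) (at t)"
      "t * h2 t + h1 t + h t = - j1 t"
      using power_series_bessel_operator[OF summable_Y_coeff, of t]
        termdiff_converges_all[OF summable_J_coeff, of t]
      unfolding h_def[abs_def] j1_def[abs_def] h1_def[abs_def] h2_def[abs_def]
      by (simp_all add: suminf_minus)
  qed
  have "j2 t = - (J_red t + j1 t) / t" if "t > 0" for t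
    using J(3)[of t] that by (simp add: field_simps)
  then have "bessel_solution J_red j1"
    unfolding bessel_solution_def using J(1,2) by metis
  then show "\<exists>f'. bessel_solution J_red f'" by blast
  define L where "L t = ln t + 2 * euler_mascheroni" for t :: real
  have L: "(L has_real_derivative 1 / t) (at t)" if "t > 0" for t
    unfolding L_def[abs_def] using that by (auto intro!: derivative_eq_intros)
  define y1 where "y1 t = (L t * j1 t + 1 / t * J_red t + 2 * h1 t) / pi" for t
  have Y_red_eq: "Y_red t = (L t * J_red t + 2 * h t) / pi" for t
    by (simp add: Y_red_def h_def L_def field_simps)
  have d1: "(Y_red has_real_derivative y1 t) (at t)" if "t > 0" for t
    unfolding Y_red_eq[abs_def] y1_def
    by (rule derivative_eq_intros refl J Y L that | simp)+
  have d2: "(y1 has_real_derivative - (Y_red t + y1 t) / t) (at t)" if "t > 0" for t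
  proof -
    have "(y1 has_real_derivative ((L t * j2 t + 1 / t * j1 t)
       + (1 / t * j1 t - 1 / t\<^sup>2 * J_red t) + 2 * h2 t) / pi) (at t)"
      unfolding y1_def[abs_def]
      by (rule derivative_eq_intros refl J Y L that | use that in \<open>simp add: power2_eq_square\<close>)+
    moreover have j2: "j2 t = - (J_red t + j1 t) / t" and h2: "h2 t = - (j1 t + h1 t + h t) / t"
      using J(3)[of t] Y(3)[of t] that by (simp_all add: field_simps)
    have "((L t * j2 t + 1 / t * j1 t) + (1 / t * j1 t - 1 / t\<^sup>2 * J_red t) + 2 * h2 t) / pi
        = - (Y_red t + y1 t) / t"
      unfolding j2 h2 Y_red_eq y1_def
      using that by (simp add: divide_simps power2_eq_square) (simp add: algebra_simps)
    ultimately show ?thesis by simp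
  qed
  from d1 d2 show "\<exists>f'. bessel_solution Y_red f'"
    unfolding bessel_solution_def by blast
qed

section \<open>A hyperbolic equation with characteristic data\<close>

text \<open>Uniqueness is obtained by bounding the weighted supremum of \<open>F\<close>
  with weight \<open>exp (- \<lambda> (a + b))\<close> by \<open>C / \<lambda>\<^sup>2\<close> times itself.\<close>

lemma goursat_unique_square:
  fixes F H q :: "real \<Rightarrow> real \<Rightarrow> real"
  assumes cont: "continuous_on ({0..1} \<times> {0..1}) (\<lambda>(a, b). F a b)"
    and F_b: "\<And>a b. a \<in> {0..1} \<Longrightarrow> b \<in> {0..1} \<Longrightarrow> (F a has_real_derivative H a b) (at b)"
    and H_a: "\<And>a b. a \<in> {0..1} \<Longrightarrow> b \<in> {0..1} \<Longrightarrow> ((\<lambda>a. H a b) has_real_derivative q a b * F a b) (at a)"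
    and q: "\<And>a b. a \<in> {0..1} \<Longrightarrow> b \<in> {0..1} \<Longrightarrow> \<bar>q a b\<bar> \<le> C"
    and zero_a: "\<And>a. a \<in> {0..1} \<Longrightarrow> F a 0 = 0"
    and zero_b: "\<And>b. b \<in> {0..1} \<Longrightarrow> F 0 b = 0"
    and ab: "a \<in> {0..1}" "b \<in> {0..1}"
  shows "F a b = 0"
proof -
  \<comment> \<open>This choice makes the factor \<open>C / (l * l)\<close>, gained by integrating
    twice against the weight, less than 1.\<close>
  define l where "l = 1 + C"
  have C: "C \<ge> 0" using q[of 0 0] by simp
  have "l > 0" "C < l * l"
    using C by (simp_all add: l_def distrib_left distrib_right add_nonneg_pos add_pos_nonneg)
  note l = this
  define W where "W = (\<lambda>(a, b). \<bar>F a b\<bar> * exp (- l * (a + b)))"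
  have "continuous_on ({0..1} \<times> {0..1}) W"
    unfolding W_def case_prod_unfold
    by (intro continuous_intros cont[unfolded case_prod_unfold])
  moreover have "compact ({0..1::real} \<times> {0..1::real})" by (intro compact_Times) auto
  moreover have "{0..1::real} \<times> {0..1::real} \<noteq> {}" by simp
  ultimately obtain p where p: "p \<in> {0..1} \<times> {0..1}" "\<And>z. z \<in> {0..1} \<times> {0..1} \<Longrightarrow> W z \<le> W p"
    using continuous_attains_sup[of "{0..1::real} \<times> {0..1::real}" W] by blast
  define M where "M = W p"
  have M0: "M \<ge> 0" by (auto simp: M_def W_def split: prod.split)
  have bound: "\<bar>F a b\<bar> \<le> M * exp (l * (a + b))" if "a \<in> {0..1}" "b \<in> {0..1}" for a b
  proof -
    have "\<bar>F a b\<bar> = W (a, b) * exp (l * (a + b))"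
      by (simp add: W_def exp_minus)
    also have "\<dots> \<le> M * exp (l * (a + b))"
      using p(2)[of "(a, b)"] that unfolding M_def by (intro mult_right_mono) auto
    finally show ?thesis .
  qed
  \<comment> \<open>\<open>F 0\<close> is known to vanish only on \<open>{0..1}\<close>, so its
    two-sided derivative is read off at interior points.\<close>
  have H0: "H 0 b = 0" if "b \<in> {0<..<1}" for b
  proof -
    have "(F 0 has_real_derivative 0) (at b)"
      by (rule has_field_derivative_transform_within_open[where f = "\<lambda>_. 0" and S = "{0<..<1}"])
        (use that zero_b in auto)
    then show ?thesis
      using F_b[of 0 b] that DERIV_unique by fastforce
  qed
  have H_bound: "\<bar>H a b\<bar> \<le> C * M / l * exp (l * (a + b))" if "a \<in> {0..1}" "b \<in> {0<..<1}" for a b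
  proof (cases "a = 0")
    case True
    then show ?thesis using H0[OF that(2)] C M0 l by simp
  next
    case False
    then have "0 < a" using that by simp
    \<comment> \<open>Integration from the edge \<open>a = 0\<close> gains a factor
      \<open>1 / l\<close>; the integration of \<open>H\<close> from \<open>b = 0\<close> below
      gains the second.\<close>
    have "norm (H a b - H 0 b) \<le> C * M / l * exp (l * (a + b)) - C * M / l * exp (l * (0 + b))"
    proof (rule differentiable_bound_general[OF \<open>0 < a\<close>, where f = "\<lambda>a. H a b" and \<phi> = "\<lambda>a. C * M / l * exp (l * (a + b))"
          and f' = "\<lambda>a. q a b * F a b" and \<phi>' = "\<lambda>a. C * M * exp (l * (a + b))"])
      show "continuous_on {0..a} (\<lambda>a. H a b)"
        by (rule DERIV_continuous_on, rule has_field_derivative_at_within, rule H_a) (use that in auto)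
      show "continuous_on {0..a} (\<lambda>a. C * M / l * exp (l * (a + b)))"
        by (intro continuous_intros)
      show "((\<lambda>a. H a b) has_vector_derivative q x b * F x b) (at x)" if "0 < x" "x < a" for x
        using H_a[of x b] that \<open>a \<in> _\<close> \<open>b \<in> _\<close> by (simp add: has_real_derivative_iff_has_vector_derivative)
      show "((\<lambda>a. C * M / l * exp (l * (a + b))) has_vector_derivative C * M * exp (l * (x + b))) (at x)" for x
        unfolding has_real_derivative_iff_has_vector_derivative[symmetric] using l
        by (auto intro!: derivative_eq_intros)
      show "norm (q x b * F x b) \<le> C * M * exp (l * (x + b))" if "0 < x" "x < a" for x
        using mult_mono[OF q[of x b] bound[of x b]] that \<open>a \<in> _\<close> \<open>b \<in> _\<close> C by (simp add: abs_mult mult.assoc)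
    qed
    moreover have "C * M / l * exp (l * (0 + b)) \<ge> 0" using C M0 l by simp
    ultimately show ?thesis using H0[OF that(2)] by simp
  qed
  have F_bound: "\<bar>F a b\<bar> \<le> C * M / (l * l) * exp (l * (a + b))" if "a \<in> {0..1}" "b \<in> {0..1}" for a b
  proof (cases "b = 0")
    case True
    then show ?thesis using zero_a[OF that(1)] C M0 l by simp
  next
    case False
    then have "0 < b" using that by simp
    have "norm (F a b - F a 0) \<le> C * M / (l * l) * exp (l * (a + b)) - C * M / (l * l) * exp (l * (a + 0))"
    proof (rule differentiable_bound_general[OF \<open>0 < b\<close>, where f = "F a" and \<phi> = "\<lambda>b. C * M / (l * l) * exp (l * (a + b))"
          and f' = "H a" and \<phi>' = "\<lambda>b. C * M / l * exp (l * (a + b))"])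
      show "continuous_on {0..b} (F a)"
        by (rule DERIV_continuous_on, rule has_field_derivative_at_within, rule F_b) (use that in auto)
      show "continuous_on {0..b} (\<lambda>b. C * M / (l * l) * exp (l * (a + b)))"
        by (intro continuous_intros)
      show "(F a has_vector_derivative H a x) (at x)" if "0 < x" "x < b" for x
        using F_b[of a x] that \<open>a \<in> _\<close> \<open>b \<in> _\<close> by (simp add: has_real_derivative_iff_has_vector_derivative)
      show "((\<lambda>b. C * M / (l * l) * exp (l * (a + b))) has_vector_derivative C * M / l * exp (l * (a + x))) (at x)" for x
        unfolding has_real_derivative_iff_has_vector_derivative[symmetric] using l
        by (auto intro!: derivative_eq_intros)
      show "norm (H a x) \<le> C * M / l * exp (l * (a + x))" if "0 < x" "x < b" for x
        using H_bound[of a x] that \<open>a \<in> _\<close> \<open>b \<in> _\<close> by simp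
    qed
    moreover have "C * M / (l * l) * exp (l * (a + 0)) \<ge> 0" using C M0 l by simp
    ultimately show ?thesis using zero_a[OF that(1)] by simp
  qed
  have "M = 0"
  proof (rule ccontr)
    assume "M \<noteq> 0"
    then have "M > 0" using M0 by simp
    obtain a0 b0 where p_eq: "p = (a0, b0)" by (cases p)
    \<comment> \<open>The supremum \<open>M\<close> is attained at \<open>p\<close>, so the improved
      bound at this point gives \<open>M < M\<close>.\<close>
    have "M = \<bar>F a0 b0\<bar> * exp (- (l * (a0 + b0)))"
      unfolding M_def p_eq W_def by simp
    also have "\<dots> \<le> C * M / (l * l) * exp (l * (a0 + b0)) * exp (- (l * (a0 + b0)))"
      using F_bound[of a0 b0] p(1) unfolding p_eq by (intro mult_right_mono) auto
    also have "\<dots> = C / (l * l) * M"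
      by (simp add: exp_minus)
    also have "\<dots> < 1 * M"
      using l \<open>M > 0\<close> by (intro mult_strict_right_mono) (simp_all add: field_simps)
    finally show False by simp
  qed
  then show ?thesis using bound[OF ab] by simp
qed

text \<open>A weak form of \<open>\<partial>\<^sub>x\<^sup>2 G - \<partial>\<^sub>y\<^sup>2 G = (\<phi> x - \<phi> y) G\<close> in the characteristic coordinates
  \<open>x = a + b\<close>, \<open>y = a - b\<close>; \<open>H\<close> is the derivative of \<open>G\<close> along \<open>b\<close>.\<close>

definition separated_wave :: "real \<Rightarrow> (real \<Rightarrow> real) \<Rightarrow> (real \<Rightarrow> real \<Rightarrow> real) \<Rightarrow> bool" where
  "separated_wave m \<phi> G \<longleftrightarrow>
    continuous_on ({- m<..<m} \<times> {- m<..<m}) (\<lambda>(x, y). G x y) \<and>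
    (\<exists>H. \<forall>a b. \<bar>a + b\<bar> < m \<longrightarrow> \<bar>a - b\<bar> < m \<longrightarrow>
      ((\<lambda>b. G (a + b) (a - b)) has_real_derivative H a b) (at b) \<and>
      ((\<lambda>a. H a b) has_real_derivative (\<phi> (a + b) - \<phi> (a - b)) * G (a + b) (a - b)) (at a))"

lemma separated_wave_diff:
  assumes "separated_wave m \<phi> G" "separated_wave m \<phi> K"
  shows "separated_wave m \<phi> (\<lambda>x y. G x y - K x y)"
proof -
  from assms obtain H J where *: "\<forall>a b. \<bar>a + b\<bar> < m \<longrightarrow> \<bar>a - b\<bar> < m \<longrightarrow>
      ((\<lambda>b. G (a + b) (a - b)) has_real_derivative H a b) (at b) \<and>
      ((\<lambda>a. H a b) has_real_derivative (\<phi> (a + b) - \<phi> (a - b)) * G (a + b) (a - b)) (at a)"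
    "\<forall>a b. \<bar>a + b\<bar> < m \<longrightarrow> \<bar>a - b\<bar> < m \<longrightarrow>
      ((\<lambda>b. K (a + b) (a - b)) has_real_derivative J a b) (at b) \<and>
      ((\<lambda>a. J a b) has_real_derivative (\<phi> (a + b) - \<phi> (a - b)) * K (a + b) (a - b)) (at a)"
    unfolding separated_wave_def by auto
  have "continuous_on ({- m<..<m} \<times> {- m<..<m}) (\<lambda>(x, y). G x y - K x y)"
    using assms unfolding separated_wave_def case_prod_unfold by (intro continuous_on_diff) auto
  moreover have "\<forall>a b. \<bar>a + b\<bar> < m \<longrightarrow> \<bar>a - b\<bar> < m \<longrightarrow>
      ((\<lambda>b. G (a + b) (a - b) - K (a + b) (a - b)) has_real_derivative H a b - J a b) (at b) \<and>
      ((\<lambda>a. H a b - J a b) has_real_derivative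
        (\<phi> (a + b) - \<phi> (a - b)) * (G (a + b) (a - b) - K (a + b) (a - b))) (at a)"
    using * by (auto simp: right_diff_distrib intro!: DERIV_diff)
  ultimately show ?thesis
    unfolding separated_wave_def by (intro conjI exI[of _ "\<lambda>a b. H a b - J a b"])
qed

text \<open>In the coordinates \<open>a\<close>, \<open>b\<close> the characteristics are the axes,
  and \<open>(x, y)\<close> becomes the corner \<open>(A, B)\<close> of a rectangle with two sides
  on them. It lies in the domain because \<open>\<bar>A\<bar> + \<bar>B\<bar> < m\<close>. Scaling
  by \<open>A\<close> and \<open>B\<close>, of either sign, reduces to the unit square.\<close>

lemma separated_wave_unique:
  assumes wave: "separated_wave m \<phi> G"
    and phi: "continuous_on {- m<..<m} \<phi>"
    and diag: "\<And>x. \<bar>x\<bar> < m \<Longrightarrow> G x x = 0"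
    and antidiag: "\<And>x. \<bar>x\<bar> < m \<Longrightarrow> G x (- x) = 0"
    and xy: "\<bar>x\<bar> < m" "\<bar>y\<bar> < m"
  shows "G x y = 0"
proof -
  define A B where "A = (x + y) / 2" and "B = (x - y) / 2"
  have "\<bar>x + y\<bar> + \<bar>x - y\<bar> < 2 * m" using xy by linarith
  then have AB: "\<bar>A\<bar> + \<bar>B\<bar> < m" by (simp add: A_def B_def)
  from wave obtain H where H: "\<And>a b. \<bar>a + b\<bar> < m \<Longrightarrow> \<bar>a - b\<bar> < m \<Longrightarrow>
      ((\<lambda>b. G (a + b) (a - b)) has_real_derivative H a b) (at b)"
    "\<And>a b. \<bar>a + b\<bar> < m \<Longrightarrow> \<bar>a - b\<bar> < m \<Longrightarrow>
      ((\<lambda>a. H a b) has_real_derivative (\<phi> (a + b) - \<phi> (a - b)) * G (a + b) (a - b)) (at a)"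
    unfolding separated_wave_def by blast
  have small: "\<bar>a * A + b * B\<bar> < m" "\<bar>a * A - b * B\<bar> < m" if "a \<in> {0..1}" "b \<in> {0..1}" for a b
  proof -
    have "\<bar>a * A\<bar> \<le> \<bar>A\<bar>" "\<bar>b * B\<bar> \<le> \<bar>B\<bar>"
      using that by (auto simp: abs_mult intro!: mult_left_le_one_le)
    then show "\<bar>a * A + b * B\<bar> < m" "\<bar>a * A - b * B\<bar> < m" using AB by linarith+
  qed
  define F where "F a b = G (a * A + b * B) (a * A - b * B)" for a b
  define H' where "H' a b = B * H (a * A) (b * B)" for a b
  define q where "q a b = A * B * (\<phi> (a * A + b * B) - \<phi> (a * A - b * B))" for a b
  have "continuous_on ({0..1} \<times> {0..1}) (\<lambda>z. q (fst z) (snd z))"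
    unfolding q_def
    by (intro continuous_intros continuous_on_compose2[OF phi]) (use small in \<open>fastforce simp: abs_less_iff\<close>)+
  then have "compact ((\<lambda>z. q (fst z) (snd z)) ` ({0..1} \<times> {0..1}))"
    by (intro compact_continuous_image compact_Times) auto
  then obtain C where C: "\<And>z. z \<in> (\<lambda>z. q (fst z) (snd z)) ` ({0..1} \<times> {0..1}) \<Longrightarrow> \<bar>z\<bar> \<le> C"
    using compact_imp_bounded bounded_real by metis
  have contG: "continuous_on ({- m<..<m} \<times> {- m<..<m}) (\<lambda>z. G (fst z) (snd z))"
    using wave unfolding separated_wave_def case_prod_unfold by blast
  have "F 1 1 = 0"
  proof (rule goursat_unique_square[of F H' q C])
    have "continuous_on ({0..1} \<times> {0..1})
        (\<lambda>z. G (fst (fst z * A + snd z * B, fst z * A - snd z * B)) (snd (fst z * A + snd z * B, fst z * A - snd z * B)))"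
      by (rule continuous_on_compose2[OF contG, where f = "\<lambda>z. (fst z * A + snd z * B, fst z * A - snd z * B)"])
        (use small in \<open>fastforce intro!: continuous_intros simp: abs_less_iff\<close>)+
    then show "continuous_on ({0..1} \<times> {0..1}) (\<lambda>(a, b). F a b)"
      by (simp add: F_def case_prod_unfold)
  next
    fix a b :: real assume ab: "a \<in> {0..1}" "b \<in> {0..1}"
    show "(F a has_real_derivative H' a b) (at b)"
      unfolding F_def[abs_def] H'_def
      by (rule DERIV_chain'[where g = "\<lambda>b. G (a * A + b) (a * A - b)" and f = "\<lambda>b. b * B" and D = B,
            THEN DERIV_cong])
        (use H(1) small[OF ab] in \<open>auto intro!: derivative_eq_intros\<close>)
    have "((\<lambda>a. H (a * A) (b * B)) has_real_derivative A * ((\<phi> (a * A + b * B) - \<phi> (a * A - b * B)) * F a b)) (at a)"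
      unfolding F_def
      by (rule DERIV_chain'[where g = "\<lambda>a. H a (b * B)" and f = "\<lambda>a. a * A" and D = A, THEN DERIV_cong])
        (use H(2) small[OF ab] in \<open>auto intro!: derivative_eq_intros\<close>)
    then show "((\<lambda>a. H' a b) has_real_derivative q a b * F a b) (at a)"
      unfolding H'_def q_def by (auto intro!: derivative_eq_intros)
    show "\<bar>q a b\<bar> \<le> C"
      using C[of "q a b"] ab by force
    show "F a 0 = 0" using diag[of "a * A"] small[OF ab(1), of 0] by (simp add: F_def)
    show "F 0 b = 0" using antidiag[of "b * B"] small[OF _ ab(2), of 0] by (simp add: F_def)
  qed auto
  then show ?thesis
    by (simp add: F_def A_def B_def field_simps)
qed

section \<open>Integrals of products of separated kernels\<close>

text \<open>The equation \<open>\<partial>\<^sub>x\<^sup>2 U = \<epsilon> \<partial>\<^sub>t\<^sup>2 U + (\<phi> x + \<psi> t) U\<close>, with \<open>U\<close> of period \<open>2 \<pi>\<close> in \<open>t\<close>.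
  The derivatives in \<open>x\<close> are \<open>U1\<close>, \<open>U2\<close>; the derivative in \<open>t\<close> is \<open>T\<close>.\<close>

definition separated_kernel ::
    "real \<Rightarrow> real \<Rightarrow> (real \<Rightarrow> real) \<Rightarrow> (real \<Rightarrow> real) \<Rightarrow> (real \<Rightarrow> real \<Rightarrow> real) \<Rightarrow> bool" where
  "separated_kernel m \<epsilon> \<phi> \<psi> U \<longleftrightarrow> (\<exists>U1 U2 T.
    continuous_on ({- m<..<m} \<times> UNIV) (\<lambda>(x, t). U x t) \<and>
    continuous_on ({- m<..<m} \<times> UNIV) (\<lambda>(x, t). U1 x t) \<and>
    continuous_on ({- m<..<m} \<times> UNIV) (\<lambda>(x, t). U2 x t) \<and>
    (\<forall>x t. \<bar>x\<bar> < m \<longrightarrow>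
      ((\<lambda>x. U x t) has_real_derivative U1 x t) (at x) \<and>
      ((\<lambda>x. U1 x t) has_real_derivative U2 x t) (at x) \<and>
      ((\<lambda>t. U x t) has_real_derivative T x t) (at t) \<and>
      ((\<lambda>t. T x t) has_real_derivative \<epsilon> * (U2 x t - (\<phi> x + \<psi> t) * U x t)) (at t) \<and>
      U x (- pi) = U x pi \<and> T x (- pi) = T x pi))"

text \<open>The mixed derivative in \<open>a\<close>, \<open>b\<close> of
  \<open>U (a + b) t * V (a - b) t\<close> is \<open>U2 V - U V2\<close>, as the terms
  \<open>U1 V1\<close> cancel. By the kernel equations this is
  \<open>(\<phi> x - \<phi> y) U V\<close> plus a multiple of the \<open>t\<close>-derivative of
  \<open>T V - U S\<close>, which integrates to zero by periodicity; \<open>\<psi>\<close> drops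
  out.\<close>

lemma separated_wave_integral:
  assumes U: "separated_kernel m \<epsilon> \<phi> \<psi> U" and V: "separated_kernel m \<epsilon> \<phi> \<psi> V" and eps: "\<epsilon> \<noteq> 0"
  shows "separated_wave m \<phi> (\<lambda>x y. integral {- pi..pi} (\<lambda>t. U x t * V y t))"
proof -
  from U obtain U1 U2 T where
    cU: "continuous_on ({- m<..<m} \<times> UNIV) (\<lambda>(x, t). U x t)"
      "continuous_on ({- m<..<m} \<times> UNIV) (\<lambda>(x, t). U1 x t)"
      "continuous_on ({- m<..<m} \<times> UNIV) (\<lambda>(x, t). U2 x t)" and
    dU: "\<And>x t. \<bar>x\<bar> < m \<Longrightarrow> ((\<lambda>x. U x t) has_real_derivative U1 x t) (at x)"
      "\<And>x t. \<bar>x\<bar> < m \<Longrightarrow> ((\<lambda>x. U1 x t) has_real_derivative U2 x t) (at x)"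
      "\<And>x t. \<bar>x\<bar> < m \<Longrightarrow> ((\<lambda>t. U x t) has_real_derivative T x t) (at t)"
      "\<And>x t. \<bar>x\<bar> < m \<Longrightarrow> ((\<lambda>t. T x t) has_real_derivative \<epsilon> * (U2 x t - (\<phi> x + \<psi> t) * U x t)) (at t)" and
    pU: "\<And>x. \<bar>x\<bar> < m \<Longrightarrow> U x (- pi) = U x pi" "\<And>x. \<bar>x\<bar> < m \<Longrightarrow> T x (- pi) = T x pi"
    unfolding separated_kernel_def by blast
  from V obtain V1 V2 S where
    cV: "continuous_on ({- m<..<m} \<times> UNIV) (\<lambda>(x, t). V x t)"
      "continuous_on ({- m<..<m} \<times> UNIV) (\<lambda>(x, t). V1 x t)"
      "continuous_on ({- m<..<m} \<times> UNIV) (\<lambda>(x, t). V2 x t)" and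
    dV: "\<And>x t. \<bar>x\<bar> < m \<Longrightarrow> ((\<lambda>x. V x t) has_real_derivative V1 x t) (at x)"
      "\<And>x t. \<bar>x\<bar> < m \<Longrightarrow> ((\<lambda>x. V1 x t) has_real_derivative V2 x t) (at x)"
      "\<And>x t. \<bar>x\<bar> < m \<Longrightarrow> ((\<lambda>t. V x t) has_real_derivative S x t) (at t)"
      "\<And>x t. \<bar>x\<bar> < m \<Longrightarrow> ((\<lambda>t. S x t) has_real_derivative \<epsilon> * (V2 x t - (\<phi> x + \<psi> t) * V x t)) (at t)" and
    pV: "\<And>x. \<bar>x\<bar> < m \<Longrightarrow> V x (- pi) = V x pi" "\<And>x. \<bar>x\<bar> < m \<Longrightarrow> S x (- pi) = S x pi"
    unfolding separated_kernel_def by blast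
  have comp: "continuous_on X (\<lambda>z. W (g z) (h z))"
    if "continuous_on ({- m<..<m} \<times> UNIV) (\<lambda>(x, t). W x t)"
      "continuous_on X g" "continuous_on X h" "\<And>z. z \<in> X \<Longrightarrow> \<bar>g z\<bar> < m"
    for X :: "'c::topological_space set" and g h and W :: "real \<Rightarrow> real \<Rightarrow> real"
  proof -
    have "continuous_on X (\<lambda>z. (\<lambda>(x, t). W x t) (g z, h z))"
      by (rule continuous_on_compose2[OF that(1)]) (use that in \<open>auto intro!: continuous_intros simp: abs_less_iff\<close>,
          (metis minus_less_iff)+)
    then show ?thesis by simp
  qed
  note cc = comp[OF cU(1)] comp[OF cU(2)] comp[OF cU(3)] comp[OF cV(1)] comp[OF cV(2)] comp[OF cV(3)]
  have shift_plus: "((\<lambda>z. f (z + c)) has_real_derivative D) (at z)"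
    if "(f has_real_derivative D) (at (z + c))" for f :: "real \<Rightarrow> real" and D c z
    using that by (simp add: DERIV_shift)
  have shift_minus: "((\<lambda>z. f (z - c)) has_real_derivative D) (at z)"
    if "(f has_real_derivative D) (at (z - c))" for f :: "real \<Rightarrow> real" and D c z
    using shift_plus[of f D z "- c"] that by simp
  define H where "H a b = integral {- pi..pi} (\<lambda>t. U1 (a + b) t * V (a - b) t - U (a + b) t * V1 (a - b) t)" for a b
  have "continuous_on ({- m<..<m} \<times> {- m<..<m}) (\<lambda>z. integral {- pi..pi} (\<lambda>t. U (fst z) t * V (snd z) t))"
    unfolding box_real[symmetric] case_prod_unfold
    by (rule integral_continuous_on_param, unfold case_prod_unfold, intro continuous_intros cc)
      (auto simp: abs_less_iff)
  moreover have "((\<lambda>b. integral {- pi..pi} (\<lambda>t. U (a + b) t * V (a - b) t)) has_real_derivative H a b) (at b)"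
    and "((\<lambda>a. H a b) has_real_derivative (\<phi> (a + b) - \<phi> (a - b)) *
        integral {- pi..pi} (\<lambda>t. U (a + b) t * V (a - b) t)) (at a)"
    if ab: "\<bar>a + b\<bar> < m" "\<bar>a - b\<bar> < m" for a b
  proof -
    define X where "X = {- m - a<..<m - a} \<inter> {a - m<..<a + m}"
    have X: "open X" "convex X" "b \<in> X" and inX: "\<And>z. z \<in> X \<Longrightarrow> \<bar>a + z\<bar> < m \<and> \<bar>a - z\<bar> < m"
      using ab by (auto simp: X_def intro!: convex_Int)
    have "((\<lambda>b. integral (cbox (- pi) pi) (\<lambda>t. U (a + b) t * V (a - b) t)) has_real_derivative
        integral (cbox (- pi) pi) (\<lambda>t. U1 (a + b) t * V (a - b) t - U (a + b) t * V1 (a - b) t)) (at b within X)"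
    proof (rule leibniz_rule_field_derivative[OF _ _ _ X(3,2)])
      fix z t assume z: "z \<in> X"
      have "((\<lambda>z. U (a + z) t) has_real_derivative U1 (a + z) t) (at z)"
        using inX[OF z] shift_plus[OF dU(1), of z a] by (simp add: add.commute)
      moreover have "((\<lambda>z. V (a - z) t) has_real_derivative - V1 (a - z) t) (at z)"
        by (rule DERIV_chain'[where g = "\<lambda>x. V x t" and f = "\<lambda>z. a - z" and D = "- 1", THEN DERIV_cong])
          (use dV(1) inX[OF z] in \<open>auto intro!: derivative_eq_intros\<close>)
      ultimately have "((\<lambda>z. U (a + z) t * V (a - z) t) has_real_derivative
          U1 (a + z) t * V (a - z) t - U (a + z) t * V1 (a - z) t) (at z)"
        by (auto intro!: derivative_eq_intros)
      then show "((\<lambda>z. U (a + z) t * V (a - z) t) has_real_derivative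
          U1 (a + z) t * V (a - z) t - U (a + z) t * V1 (a - z) t) (at z within X)"
        by (rule has_field_derivative_at_within)
    next
      fix z assume z: "z \<in> X"
      show "(\<lambda>t. U (a + z) t * V (a - z) t) integrable_on cbox (- pi) pi"
        by (rule integrable_continuous, intro continuous_intros cc) (use inX[OF z] in auto)
    next
      show "continuous_on (X \<times> cbox (- pi) pi) (\<lambda>(z, t). U1 (a + z) t * V (a - z) t - U (a + z) t * V1 (a - z) t)"
        unfolding case_prod_unfold by (intro continuous_intros cc) (use inX in auto)
    qed
    then show "((\<lambda>b. integral {- pi..pi} (\<lambda>t. U (a + b) t * V (a - b) t)) has_real_derivative H a b) (at b)"
      unfolding H_def at_within_open[OF X(3,1)] box_real .
  next
    define X where "X = {- m - b<..<m - b} \<inter> {b - m<..<b + m}"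
    have X: "open X" "convex X" "a \<in> X" and inX: "\<And>z. z \<in> X \<Longrightarrow> \<bar>z + b\<bar> < m \<and> \<bar>z - b\<bar> < m"
      using ab by (auto simp: X_def intro!: convex_Int)
    have "((\<lambda>a. integral (cbox (- pi) pi) (\<lambda>t. U1 (a + b) t * V (a - b) t - U (a + b) t * V1 (a - b) t)) has_real_derivative
        integral (cbox (- pi) pi) (\<lambda>t. U2 (a + b) t * V (a - b) t - U (a + b) t * V2 (a - b) t)) (at a within X)"
    proof (rule leibniz_rule_field_derivative[OF _ _ _ X(3,2)])
      fix z t assume z: "z \<in> X"
      have "((\<lambda>z. U (z + b) t) has_real_derivative U1 (z + b) t) (at z)"
        "((\<lambda>z. U1 (z + b) t) has_real_derivative U2 (z + b) t) (at z)"
        "((\<lambda>z. V (z - b) t) has_real_derivative V1 (z - b) t) (at z)"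
        "((\<lambda>z. V1 (z - b) t) has_real_derivative V2 (z - b) t) (at z)"
        using inX[OF z] by (auto intro!: shift_plus shift_minus dU(1,2) dV(1,2))
      then have "((\<lambda>z. U1 (z + b) t * V (z - b) t - U (z + b) t * V1 (z - b) t) has_real_derivative
          U2 (z + b) t * V (z - b) t - U (z + b) t * V2 (z - b) t) (at z)"
        by (auto intro!: derivative_eq_intros)
      then show "((\<lambda>z. U1 (z + b) t * V (z - b) t - U (z + b) t * V1 (z - b) t) has_real_derivative
          U2 (z + b) t * V (z - b) t - U (z + b) t * V2 (z - b) t) (at z within X)"
        by (rule has_field_derivative_at_within)
    next
      fix z assume z: "z \<in> X"
      show "(\<lambda>t. U1 (z + b) t * V (z - b) t - U (z + b) t * V1 (z - b) t) integrable_on cbox (- pi) pi"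
        by (rule integrable_continuous, intro continuous_intros cc) (use inX[OF z] in auto)
    next
      show "continuous_on (X \<times> cbox (- pi) pi) (\<lambda>(z, t). U2 (z + b) t * V (z - b) t - U (z + b) t * V2 (z - b) t)"
        unfolding case_prod_unfold by (intro continuous_intros cc) (use inX in auto)
    qed
    then have deriv: "((\<lambda>a. H a b) has_real_derivative
        integral {- pi..pi} (\<lambda>t. U2 (a + b) t * V (a - b) t - U (a + b) t * V2 (a - b) t)) (at a)"
      unfolding H_def at_within_open[OF X(3,1)] box_real .
    define x y where "x = a + b" and "y = a - b"
    have xy: "\<bar>x\<bar> < m" "\<bar>y\<bar> < m" using ab by (simp_all add: x_def y_def)
    have "((\<lambda>t. \<epsilon> * ((U2 x t * V y t - U x t * V2 y t) - (\<phi> x - \<phi> y) * (U x t * V y t))) has_integral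
        (T x pi * V y pi - U x pi * S y pi) - (T x (- pi) * V y (- pi) - U x (- pi) * S y (- pi))) {- pi..pi}"
    proof (rule fundamental_theorem_of_calculus)
      fix t
      have "((\<lambda>t. T x t * V y t - U x t * S y t) has_real_derivative
          \<epsilon> * ((U2 x t * V y t - U x t * V2 y t) - (\<phi> x - \<phi> y) * (U x t * V y t))) (at t)"
        using dU(3,4)[OF xy(1)] dV(3,4)[OF xy(2)]
        by (auto intro!: derivative_eq_intros simp: algebra_simps)
      then show "((\<lambda>t. T x t * V y t - U x t * S y t) has_vector_derivative
          \<epsilon> * ((U2 x t * V y t - U x t * V2 y t) - (\<phi> x - \<phi> y) * (U x t * V y t))) (at t within {- pi..pi})"
        using has_field_derivative_at_within has_real_derivative_iff_has_vector_derivative by blast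
    qed simp
    \<comment> \<open>The boundary terms agree by periodicity; the form
      \<open>\<epsilon> * 0\<close> prepares for dividing by \<open>\<epsilon>\<close>.\<close>
    then have "((\<lambda>t. \<epsilon> * ((U2 x t * V y t - U x t * V2 y t) - (\<phi> x - \<phi> y) * (U x t * V y t))) has_integral \<epsilon> * 0) {- pi..pi}"
      using pU[OF xy(1)] pV[OF xy(2)] by simp
    then have diff: "((\<lambda>t. (U2 x t * V y t - U x t * V2 y t) - (\<phi> x - \<phi> y) * (U x t * V y t)) has_integral 0) {- pi..pi}"
      using has_integral_mult_right[of _ "\<epsilon> * 0" "{- pi..pi}" "inverse \<epsilon>"] eps
      by (fastforce simp flip: mult.assoc)
    have "((\<lambda>t. (\<phi> x - \<phi> y) * (U x t * V y t)) has_integral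
        (\<phi> x - \<phi> y) * integral {- pi..pi} (\<lambda>t. U x t * V y t)) {- pi..pi}"
      by (intro has_integral_mult_right integrable_integral integrable_continuous_interval continuous_intros cc)
        (use xy in auto)
    from has_integral_add[OF diff this]
    have "((\<lambda>t. U2 x t * V y t - U x t * V2 y t) has_integral
        (\<phi> x - \<phi> y) * integral {- pi..pi} (\<lambda>t. U x t * V y t)) {- pi..pi}"
      by simp
    then show "((\<lambda>a. H a b) has_real_derivative (\<phi> (a + b) - \<phi> (a - b)) *
        integral {- pi..pi} (\<lambda>t. U (a + b) t * V (a - b) t)) (at a)"
      using deriv by (simp add: integral_unique x_def y_def)
  qed
  ultimately show ?thesis
    unfolding separated_wave_def case_prod_unfold by blast
qed

section \<open>Elliptic coordinates\<close>

definition dist_sq :: "real \<Rightarrow> real \<Rightarrow> real \<Rightarrow> real \<Rightarrow> real" where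
  "dist_sq x e a t = (cosh (x + a) - cos (e + t)) * (cosh (x - a) - cos (e - t))"

lemma dist_elliptic: "dist (elliptic x e) (elliptic a t) = sqrt (dist_sq x e a t)"
proof -
  have h: "(cosh x)\<^sup>2 = (sinh x)\<^sup>2 + 1" "(cosh a)\<^sup>2 = (sinh a)\<^sup>2 + 1"
    "(cos e)\<^sup>2 + (sin e)\<^sup>2 = 1" "(cos t)\<^sup>2 + (sin t)\<^sup>2 = 1"
    by (simp_all add: cosh_square_eq)
  have "(cosh x * cos e - cosh a * cos t)\<^sup>2 + (sinh x * sin e - sinh a * sin t)\<^sup>2 = dist_sq x e a t"
    unfolding dist_sq_def cosh_add cosh_diff cos_add cos_diff using h by algebra
  then show ?thesis
    by (simp add: elliptic_def dist_prod_def dist_real_def)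
qed

lemma dist_sq_pos:
  assumes "\<bar>x\<bar> < a"
  shows "dist_sq x e a t > 0"
proof -
  have "cosh z > 1" if "z \<noteq> 0" for z :: real
    using cosh_real_nonneg_less_iff[of 0 "\<bar>z\<bar>"] that by simp
  from this[of "x + a"] this[of "x - a"] have "cosh (x + a) > 1" "cosh (x - a) > 1"
    using assms by auto
  then have "cosh (x + a) > cos (e + t)" "cosh (x - a) > cos (e - t)"
    using cos_le_one[of "e + t"] cos_le_one[of "e - t"] by linarith+
  then show ?thesis by (simp add: dist_sq_def)
qed

text \<open>\<open>(x, e)\<close> and \<open>(- x, - e)\<close> are elliptic coordinates of the same
  point; the two factors trade places.\<close>

lemma dist_sq_uminus_left: "dist_sq (- x) (- e) a t = dist_sq x e a t"
proof -
  have "- x + a = - (x - a)" "- x - a = - (x + a)" "- e + t = - (e - t)" "- e - t = - (e + t)"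
    by simp_all
  then show ?thesis by (simp only: dist_sq_def cosh_minus cos_minus mult.commute)
qed

text \<open>Both points are reflected in the first coordinate axis, which is an isometry.\<close>

lemma dist_sq_uminus_angles: "dist_sq x (- e) a (- t) = dist_sq x e a t"
proof -
  have "cos (t - e) = cos (e - t)" "cos (- e - t) = cos (e + t)"
    using cos_minus[of "e - t"] cos_minus[of "e + t"] by simp_all
  then show ?thesis by (simp add: dist_sq_def)
qed

section \<open>Bessel functions of the distance as separated kernels\<close>

lemma bessel_solution_continuous_on:
  assumes "bessel_solution f f'"
  shows "continuous_on {0<..} f" and "continuous_on {0<..} f'"
  by (rule DERIV_continuous_on, rule has_field_derivative_at_within,
      use assms in \<open>force simp: bessel_solution_def\<close>)+

text \<open>For \<open>U = f (S x t)\<close> the chain rule writes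
  \<open>U\<^sub>x\<^sub>x - \<epsilon> U\<^sub>t\<^sub>t\<close> as \<open>f'' (Sx\<^sup>2 -
  \<epsilon> St\<^sup>2) + f' (Sxx - \<epsilon> Stt)\<close>. By \<open>first\<close> and
  \<open>second\<close> this is \<open>- (\<phi> x + \<psi> t) (S f'' + f')\<close>, and Bessel's
  equation turns it into \<open>(\<phi> x + \<psi> t) f\<close>.\<close>

lemma separated_kernel_bessel:
  assumes f: "bessel_solution f f'"
    and pos: "\<And>x t. \<bar>x\<bar> < m \<Longrightarrow> S x t > 0"
    and cont: "continuous_on ({- m<..<m} \<times> UNIV) (\<lambda>(x, t). S x t)"
      "continuous_on ({- m<..<m} \<times> UNIV) (\<lambda>(x, t). Sx x t)"
      "continuous_on ({- m<..<m} \<times> UNIV) (\<lambda>(x, t). Sxx x t)"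
    and Sx: "\<And>x t. ((\<lambda>x. S x t) has_real_derivative Sx x t) (at x)"
    and Sxx: "\<And>x t. ((\<lambda>x. Sx x t) has_real_derivative Sxx x t) (at x)"
    and St: "\<And>x t. ((\<lambda>t. S x t) has_real_derivative St x t) (at t)"
    and Stt: "\<And>x t. ((\<lambda>t. St x t) has_real_derivative Stt x t) (at t)"
    and periodic: "\<And>x. S x (- pi) = S x pi" "\<And>x. St x (- pi) = St x pi"
    and eps: "\<epsilon>\<^sup>2 = 1"
    and first: "\<And>x t. (Sx x t)\<^sup>2 - \<epsilon> * (St x t)\<^sup>2 = - (\<phi> x + \<psi> t) * S x t"
    and second: "\<And>x t. Sxx x t - \<epsilon> * Stt x t = - (\<phi> x + \<psi> t)"
  shows "separated_kernel m \<epsilon> \<phi> \<psi> (\<lambda>x t. f (S x t))"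
proof -
  define g where "g s = - (f s + f' s) / s" for s
  have df: "(f has_real_derivative f' s) (at s)" "(f' has_real_derivative g s) (at s)" if "s > 0" for s
    using f that unfolding bessel_solution_def g_def by blast+
  note cf = bessel_solution_continuous_on[OF f]
  then have cg: "continuous_on {0<..} g"
    unfolding g_def by (intro continuous_intros) auto
  have comp: "continuous_on ({- m<..<m} \<times> UNIV) (\<lambda>(x, t). h (S x t))" if "continuous_on {0<..} h" for h :: "real \<Rightarrow> real"
    unfolding case_prod_unfold
    by (rule continuous_on_compose2[OF that cont(1)[unfolded case_prod_unfold]])
      (auto intro!: pos simp: abs_less_iff)
  show ?thesis
    unfolding separated_kernel_def
  proof (rule exI[of _ "\<lambda>x t. f' (S x t) * Sx x t"], rule exI[of _ "\<lambda>x t. g (S x t) * (Sx x t)\<^sup>2 + f' (S x t) * Sxx x t"],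
      rule exI[of _ "\<lambda>x t. f' (S x t) * St x t"], intro conjI allI impI)
    show "continuous_on ({- m<..<m} \<times> UNIV) (\<lambda>(x, t). f (S x t))"
      by (rule comp[OF cf(1)])
    show "continuous_on ({- m<..<m} \<times> UNIV) (\<lambda>(x, t). f' (S x t) * Sx x t)"
      "continuous_on ({- m<..<m} \<times> UNIV) (\<lambda>(x, t). g (S x t) * (Sx x t)\<^sup>2 + f' (S x t) * Sxx x t)"
      using comp[OF cf(2)] comp[OF cg] cont(2,3) unfolding case_prod_unfold by (auto intro!: continuous_intros)
    fix x t :: real assume "\<bar>x\<bar> < m"
    note p = pos[OF this, of t]
    show "((\<lambda>x. f (S x t)) has_real_derivative f' (S x t) * Sx x t) (at x)"
      by (rule DERIV_chain'[OF Sx df(1)[OF p], THEN DERIV_cong]) simp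
    show "((\<lambda>t. f (S x t)) has_real_derivative f' (S x t) * St x t) (at t)"
      by (rule DERIV_chain'[OF St df(1)[OF p], THEN DERIV_cong]) simp
    have "((\<lambda>x. f' (S x t)) has_real_derivative g (S x t) * Sx x t) (at x)"
      by (rule DERIV_chain'[OF Sx df(2)[OF p], THEN DERIV_cong]) simp
    from DERIV_mult[OF this Sxx]
    show "((\<lambda>x. f' (S x t) * Sx x t) has_real_derivative g (S x t) * (Sx x t)\<^sup>2 + f' (S x t) * Sxx x t) (at x)"
      by (rule DERIV_cong) (simp add: power2_eq_square)
    have "((\<lambda>t. f' (S x t)) has_real_derivative g (S x t) * St x t) (at t)"
      by (rule DERIV_chain'[OF St df(2)[OF p], THEN DERIV_cong]) simp
    from DERIV_mult[OF this Stt]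
    have "((\<lambda>t. f' (S x t) * St x t) has_real_derivative g (S x t) * (St x t)\<^sup>2 + f' (S x t) * Stt x t) (at t)"
      by (rule DERIV_cong) (simp add: power2_eq_square)
    moreover have "g (S x t) * S x t + f' (S x t) + f (S x t) = 0"
      using p by (simp add: g_def)
    then have "g (S x t) * (St x t)\<^sup>2 + f' (S x t) * Stt x t =
        \<epsilon> * (g (S x t) * (Sx x t)\<^sup>2 + f' (S x t) * Sxx x t - (\<phi> x + \<psi> t) * f (S x t))"
      using eps first[of x t] second[of x t] by algebra
    ultimately show "((\<lambda>t. f' (S x t) * St x t) has_real_derivative
        \<epsilon> * (g (S x t) * (Sx x t)\<^sup>2 + f' (S x t) * Sxx x t - (\<phi> x + \<psi> t) * f (S x t))) (at t)"
      by simp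
  qed (simp_all add: periodic)
qed

text \<open>For \<open>P = x + a\<close>, \<open>R = x - a\<close>, \<open>Q = e + t\<close>,
  \<open>W = e - t\<close> the left side is the squared gradient of \<open>dist_sq\<close> in
  \<open>(x, t)\<close>. In free variables the identity is polynomial modulo the Pythagorean
  relations.\<close>

lemma dist_sq_gradient_radial:
  fixes P Q R W :: real
  shows "(sinh P * (cosh R - cos W) + (cosh P - cos Q) * sinh R)\<^sup>2
      + (sin Q * (cosh R - cos W) - (cosh P - cos Q) * sin W)\<^sup>2
    = 2 * (cosh (P + R) - cos (Q - W)) * ((cosh P - cos Q) * (cosh R - cos W))"
proof -
  have "(cosh P)\<^sup>2 = (sinh P)\<^sup>2 + 1" "(cosh R)\<^sup>2 = (sinh R)\<^sup>2 + 1"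
    "(cos Q)\<^sup>2 + (sin Q)\<^sup>2 = 1" "(cos W)\<^sup>2 + (sin W)\<^sup>2 = 1"
    by (simp_all add: cosh_square_eq)
  then show ?thesis
    unfolding cosh_add cos_diff by algebra
qed

text \<open>Exchanging the angles \<open>e\<close> and \<open>t\<close> leaves
  \<open>dist_sq\<close> unchanged, so \<open>(x, t)\<close> can be read as the elliptic coordinates
  of one point. The equation is Helmholtz's in these coordinates, with \<open>c\<close> for
  \<open>k\<^sup>2 / 4\<close>.\<close>

lemma separated_kernel_radial:
  assumes f: "bessel_solution f f'" and c: "c > 0" and m: "m \<le> a"
  shows "separated_kernel m (- 1) (\<lambda>x. - 2 * c * cosh (2 * x)) (\<lambda>t. 2 * c * cos (2 * t))
    (\<lambda>x t. f (c * dist_sq x e a t))"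
proof (rule separated_kernel_bessel[OF f,
      where Sx = "\<lambda>x t. c * (sinh (x + a) * (cosh (x - a) - cos (e - t)) + (cosh (x + a) - cos (e + t)) * sinh (x - a))"
        and Sxx = "\<lambda>x t. c * (cosh (x + a) * (cosh (x - a) - cos (e - t)) + 2 * sinh (x + a) * sinh (x - a)
                    + (cosh (x + a) - cos (e + t)) * cosh (x - a))"
        and St = "\<lambda>x t. c * (sin (e + t) * (cosh (x - a) - cos (e - t)) - (cosh (x + a) - cos (e + t)) * sin (e - t))"
        and Stt = "\<lambda>x t. c * (cos (e + t) * (cosh (x - a) - cos (e - t)) - 2 * sin (e + t) * sin (e - t)
                    + (cosh (x + a) - cos (e + t)) * cos (e - t))"])
  fix x t :: real
  show "((\<lambda>x. c * dist_sq x e a t) has_real_derivative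
     c * (sinh (x + a) * (cosh (x - a) - cos (e - t)) + (cosh (x + a) - cos (e + t)) * sinh (x - a))) (at x)"
    unfolding dist_sq_def by (auto intro!: derivative_eq_intros simp: algebra_simps)
  show "((\<lambda>x. c * (sinh (x + a) * (cosh (x - a) - cos (e - t)) + (cosh (x + a) - cos (e + t)) * sinh (x - a)))
     has_real_derivative c * (cosh (x + a) * (cosh (x - a) - cos (e - t)) + 2 * sinh (x + a) * sinh (x - a)
                    + (cosh (x + a) - cos (e + t)) * cosh (x - a))) (at x)"
    by (auto intro!: derivative_eq_intros simp: algebra_simps)
  show "((\<lambda>t. c * dist_sq x e a t) has_real_derivative
     c * (sin (e + t) * (cosh (x - a) - cos (e - t)) - (cosh (x + a) - cos (e + t)) * sin (e - t))) (at t)"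
    unfolding dist_sq_def by (auto intro!: derivative_eq_intros simp: algebra_simps)
  show "((\<lambda>t. c * (sin (e + t) * (cosh (x - a) - cos (e - t)) - (cosh (x + a) - cos (e + t)) * sin (e - t)))
     has_real_derivative c * (cos (e + t) * (cosh (x - a) - cos (e - t)) - 2 * sin (e + t) * sin (e - t)
                    + (cosh (x + a) - cos (e + t)) * cos (e - t))) (at t)"
    by (auto intro!: derivative_eq_intros simp: algebra_simps)
  have sums: "(x + a) + (x - a) = 2 * x" "(e + t) - (e - t) = 2 * t" by simp_all
  have "(c * (sinh (x + a) * (cosh (x - a) - cos (e - t)) + (cosh (x + a) - cos (e + t)) * sinh (x - a)))\<^sup>2 -
      - 1 * (c * (sin (e + t) * (cosh (x - a) - cos (e - t)) - (cosh (x + a) - cos (e + t)) * sin (e - t)))\<^sup>2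
     = c\<^sup>2 * ((sinh (x + a) * (cosh (x - a) - cos (e - t)) + (cosh (x + a) - cos (e + t)) * sinh (x - a))\<^sup>2
      + (sin (e + t) * (cosh (x - a) - cos (e - t)) - (cosh (x + a) - cos (e + t)) * sin (e - t))\<^sup>2)"
    by algebra
  also have "\<dots> = - (- 2 * c * cosh (2 * x) + 2 * c * cos (2 * t)) * (c * dist_sq x e a t)"
    unfolding dist_sq_gradient_radial sums dist_sq_def by algebra
  finally show "(c * (sinh (x + a) * (cosh (x - a) - cos (e - t)) + (cosh (x + a) - cos (e + t)) * sinh (x - a)))\<^sup>2 -
      - 1 * (c * (sin (e + t) * (cosh (x - a) - cos (e - t)) - (cosh (x + a) - cos (e + t)) * sin (e - t)))\<^sup>2
     = - (- 2 * c * cosh (2 * x) + 2 * c * cos (2 * t)) * (c * dist_sq x e a t)" .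
  have expand: "cosh (2 * x) = cosh (x + a) * cosh (x - a) + sinh (x + a) * sinh (x - a)"
    "cos (2 * t) = cos (e + t) * cos (e - t) + sin (e + t) * sin (e - t)"
    by (simp_all flip: cosh_add cos_diff)
  show "c * (cosh (x + a) * (cosh (x - a) - cos (e - t)) + 2 * sinh (x + a) * sinh (x - a)
         + (cosh (x + a) - cos (e + t)) * cosh (x - a))
      - - 1 * (c * (cos (e + t) * (cosh (x - a) - cos (e - t)) - 2 * sin (e + t) * sin (e - t)
         + (cosh (x + a) - cos (e + t)) * cos (e - t)))
      = - (- 2 * c * cosh (2 * x) + 2 * c * cos (2 * t))"
    unfolding expand by algebra
  show "c * dist_sq x e a t > 0" if "\<bar>x\<bar> < m"
    using that c m by (intro mult_pos_pos dist_sq_pos) auto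
qed (auto intro!: continuous_intros simp: dist_sq_def[abs_def] case_prod_unfold cos_add sin_add cos_diff sin_diff)

text \<open>The equation is the difference of the Helmholtz equations in \<open>(x, e)\<close> and
  \<open>(x, t)\<close>, where the \<open>x\<close>-derivatives cancel. With \<open>x\<close> fixed,
  positivity holds at all angles, so \<open>m\<close> is arbitrary.\<close>

lemma separated_kernel_angular:
  assumes f: "bessel_solution f f'" and c: "c > 0" and x: "\<bar>x\<bar> < a"
  shows "separated_kernel m 1 (\<lambda>e. 2 * c * cos (2 * e)) (\<lambda>t. - 2 * c * cos (2 * t))
    (\<lambda>e t. f (c * dist_sq x e a t))"
proof (rule separated_kernel_bessel[OF f,
      where Sx = "\<lambda>e t. c * (sin (e + t) * (cosh (x - a) - cos (e - t)) + (cosh (x + a) - cos (e + t)) * sin (e - t))"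
        and Sxx = "\<lambda>e t. c * (cos (e + t) * (cosh (x - a) - cos (e - t)) + 2 * sin (e + t) * sin (e - t)
                    + (cosh (x + a) - cos (e + t)) * cos (e - t))"
        and St = "\<lambda>e t. c * (sin (e + t) * (cosh (x - a) - cos (e - t)) - (cosh (x + a) - cos (e + t)) * sin (e - t))"
        and Stt = "\<lambda>e t. c * (cos (e + t) * (cosh (x - a) - cos (e - t)) - 2 * sin (e + t) * sin (e - t)
                    + (cosh (x + a) - cos (e + t)) * cos (e - t))"])
  fix e t :: real
  show "((\<lambda>e. c * dist_sq x e a t) has_real_derivative
     c * (sin (e + t) * (cosh (x - a) - cos (e - t)) + (cosh (x + a) - cos (e + t)) * sin (e - t))) (at e)"
    unfolding dist_sq_def by (auto intro!: derivative_eq_intros simp: algebra_simps)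
  show "((\<lambda>e. c * (sin (e + t) * (cosh (x - a) - cos (e - t)) + (cosh (x + a) - cos (e + t)) * sin (e - t)))
     has_real_derivative c * (cos (e + t) * (cosh (x - a) - cos (e - t)) + 2 * sin (e + t) * sin (e - t)
                    + (cosh (x + a) - cos (e + t)) * cos (e - t))) (at e)"
    by (auto intro!: derivative_eq_intros simp: algebra_simps)
  show "((\<lambda>t. c * dist_sq x e a t) has_real_derivative
     c * (sin (e + t) * (cosh (x - a) - cos (e - t)) - (cosh (x + a) - cos (e + t)) * sin (e - t))) (at t)"
    unfolding dist_sq_def by (auto intro!: derivative_eq_intros simp: algebra_simps)
  show "((\<lambda>t. c * (sin (e + t) * (cosh (x - a) - cos (e - t)) - (cosh (x + a) - cos (e + t)) * sin (e - t)))
     has_real_derivative c * (cos (e + t) * (cosh (x - a) - cos (e - t)) - 2 * sin (e + t) * sin (e - t)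
                    + (cosh (x + a) - cos (e + t)) * cos (e - t))) (at t)"
    by (auto intro!: derivative_eq_intros simp: algebra_simps)
  have expand: "cos (2 * e) = cos (e + t) * cos (e - t) - sin (e + t) * sin (e - t)"
    "cos (2 * t) = cos (e + t) * cos (e - t) + sin (e + t) * sin (e - t)"
    by (simp_all flip: cos_add cos_diff)
  show "(c * (sin (e + t) * (cosh (x - a) - cos (e - t)) + (cosh (x + a) - cos (e + t)) * sin (e - t)))\<^sup>2 -
      1 * (c * (sin (e + t) * (cosh (x - a) - cos (e - t)) - (cosh (x + a) - cos (e + t)) * sin (e - t)))\<^sup>2
     = - (2 * c * cos (2 * e) + - 2 * c * cos (2 * t)) * (c * dist_sq x e a t)"
    unfolding expand dist_sq_def by algebra
  show "c * (cos (e + t) * (cosh (x - a) - cos (e - t)) + 2 * sin (e + t) * sin (e - t)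
         + (cosh (x + a) - cos (e + t)) * cos (e - t))
      - 1 * (c * (cos (e + t) * (cosh (x - a) - cos (e - t)) - 2 * sin (e + t) * sin (e - t)
         + (cosh (x + a) - cos (e + t)) * cos (e - t)))
      = - (2 * c * cos (2 * e) + - 2 * c * cos (2 * t))"
    unfolding expand by algebra
  show "c * dist_sq x e a t > 0"
    using c x by (intro mult_pos_pos dist_sq_pos)
qed (auto intro!: continuous_intros simp: dist_sq_def[abs_def] case_prod_unfold cos_add sin_add cos_diff sin_diff)

section \<open>Symmetry of the integral of a product of two Bessel solutions\<close>

context
  fixes f f' g g' :: "real \<Rightarrow> real" and c a s :: real
  assumes f: "bessel_solution f f'" and g: "bessel_solution g g'" and c: "c > 0"
begin

text \<open>The radii \<open>a\<close> and \<open>s\<close> are kept apart so that the symmetry is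
  an identity in \<open>s\<close> and can later be differentiated.\<close>

private definition pairing :: "real \<Rightarrow> real \<Rightarrow> real \<Rightarrow> real \<Rightarrow> real" where
  "pairing x e y d = integral {- pi..pi} (\<lambda>t. f (c * dist_sq x e a t) * g (c * dist_sq y d s t))"

text \<open>Puts the factor \<open>g\<close> first, as needed when the first wave variable belongs
  to \<open>g\<close>.\<close>

private lemma pairing_commute: "pairing x e y d = integral {- pi..pi} (\<lambda>t. g (c * dist_sq y d s t) * f (c * dist_sq x e a t))"
  by (simp add: pairing_def mult.commute)

private lemma pairing_uminus_left: "pairing (- x) (- e) y d = pairing x e y d"
  by (simp add: pairing_def dist_sq_uminus_left)

private lemma pairing_uminus_right: "pairing x e (- y) (- d) = pairing x e y d"
  by (simp add: pairing_def dist_sq_uminus_left)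

private lemma pairing_uminus_angles: "pairing x (- e) y (- d) = pairing x e y d"
proof -
  have "integral {- pi..- (- pi)} (\<lambda>t. f (c * dist_sq x (- e) a (- t)) * g (c * dist_sq y (- d) s (- t))) = pairing x (- e) y (- d)"
    unfolding pairing_def
    by (rule Henstock_Kurzweil_Integration.integral_reflect_real[where f = "\<lambda>t. f (c * dist_sq x (- e) a t) * g (c * dist_sq y (- d) s t)"])
  then show ?thesis by (simp add: pairing_def dist_sq_uminus_angles)
qed

text \<open>With equal angles the difference vanishes trivially on \<open>y = x\<close>. On
  \<open>y = - x\<close> each sign change of a radius is moved to the angle of the same point, and
  reflecting both angles matches the two terms.\<close>

private lemma pairing_sym_radial:
  assumes "\<bar>x\<bar> < min a s" "\<bar>y\<bar> < min a s"
  shows "pairing x e y e = pairing y e x e"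
proof -
  have "pairing x e y e - pairing y e x e = 0"
  proof (rule separated_wave_unique[where m = "min a s" and \<phi> = "\<lambda>x. - 2 * c * cosh (2 * x)"
        and G = "\<lambda>x y. pairing x e y e - pairing y e x e"])
    have "separated_wave (min a s) (\<lambda>x. - 2 * c * cosh (2 * x)) (\<lambda>x y. pairing x e y e)"
      unfolding pairing_def
      by (rule separated_wave_integral; (rule separated_kernel_radial[OF f c] separated_kernel_radial[OF g c])?) simp_all
    moreover have "separated_wave (min a s) (\<lambda>x. - 2 * c * cosh (2 * x)) (\<lambda>x y. pairing y e x e)"
      unfolding pairing_commute
      by (rule separated_wave_integral; (rule separated_kernel_radial[OF f c] separated_kernel_radial[OF g c])?) simp_all
    ultimately show "separated_wave (min a s) (\<lambda>x. - 2 * c * cosh (2 * x)) (\<lambda>x y. pairing x e y e - pairing y e x e)"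
      by (rule separated_wave_diff)
    show "continuous_on {- min a s<..<min a s} (\<lambda>x. - 2 * c * cosh (2 * x))"
      by (intro continuous_intros)
    show "pairing x e (- x) e - pairing (- x) e x e = 0" for x
      using pairing_uminus_left[of x "- e" x e] pairing_uminus_right[of x "e" x "- e"]
        pairing_uminus_angles[of x "- e" x e] by simp
  qed (use assms in simp_all)
  then show ?thesis by simp
qed

text \<open>The radii are now fixed. The radial case gives the diagonal \<open>d = e\<close>; on
  \<open>d = - e\<close> the sign is moved from the angle to the radius \<open>y\<close>, and the
  radial case applies to \<open>x\<close> and \<open>- y\<close>.\<close>

private lemma pairing_sym:
  assumes x: "\<bar>x\<bar> < min a s" and y: "\<bar>y\<bar> < min a s"
  shows "pairing x e y d = pairing y d x e"
proof -
  define m where "m = \<bar>e\<bar> + \<bar>d\<bar> + 1"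
  have "pairing x e y d - pairing y d x e = 0"
  proof (rule separated_wave_unique[where m = m and \<phi> = "\<lambda>e. 2 * c * cos (2 * e)"
        and G = "\<lambda>e d. pairing x e y d - pairing y d x e"])
    have "separated_wave m (\<lambda>e. 2 * c * cos (2 * e)) (\<lambda>e d. pairing x e y d)"
      unfolding pairing_def
      by (rule separated_wave_integral; (rule separated_kernel_angular[OF f c] separated_kernel_angular[OF g c])?)
        (use x y in simp_all)
    moreover have "separated_wave m (\<lambda>e. 2 * c * cos (2 * e)) (\<lambda>e d. pairing y d x e)"
      unfolding pairing_commute
      by (rule separated_wave_integral; (rule separated_kernel_angular[OF f c] separated_kernel_angular[OF g c])?)
        (use x y in simp_all)
    ultimately show "separated_wave m (\<lambda>e. 2 * c * cos (2 * e)) (\<lambda>e d. pairing x e y d - pairing y d x e)"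
      by (rule separated_wave_diff)
    show "continuous_on {- m<..<m} (\<lambda>e. 2 * c * cos (2 * e))"
      by (intro continuous_intros)
    show "pairing x e y e - pairing y e x e = 0" for e
      using pairing_sym_radial[OF x y] by simp
    show "pairing x e y (- e) - pairing y (- e) x e = 0" for e
      using pairing_sym_radial[of x "- y" e] x y pairing_uminus_left[of "- y" e x e]
        pairing_uminus_right[of x e "- y" e] by simp
  qed (auto simp: m_def)
  then show ?thesis by simp
qed

lemma bessel_pairing_sym:
  assumes "\<bar>x\<bar> < min a s" "\<bar>y\<bar> < min a s"
  shows "integral {- pi..pi} (\<lambda>t. f (c * dist_sq x e a t) * g (c * dist_sq y d s t)) =
    integral {- pi..pi} (\<lambda>t. f (c * dist_sq y d a t) * g (c * dist_sq x e s t))"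
  using pairing_sym[OF assms] by (simp add: pairing_def)

end

section \<open>Passage to the normal derivative at the boundary ellipse\<close>

text \<open>Only the radius in the \<open>Y_red\<close> factor varies, since the derivative falls on
  \<open>v_fun\<close> alone. Differentiation under the integral takes place on
  \<open>s > b\<close>, where \<open>\<bar>y\<bar> < s\<close> keeps the argument of
  \<open>Y_red\<close> positive.\<close>

lemma I_int_has_derivative:
  assumes k: "k > 0" and x: "\<bar>x\<bar> < a" and y: "\<bar>y\<bar> < b" and b: "b < a"
  shows "((\<lambda>s. integral {- pi..pi} (\<lambda>t. J_red (k\<^sup>2 / 4 * dist_sq x e a t) * Y_red (k\<^sup>2 / 4 * dist_sq y d s t)))
    has_real_derivative I_int k a x e y d) (at a)"
proof -
  define c where "c = k\<^sup>2 / 4"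
  have c: "c > 0" using k by (simp add: c_def)
  obtain Y' where Y': "bessel_solution Y_red Y'" using bessel_solution_Y_red by blast
  obtain J' where J': "bessel_solution J_red J'" using bessel_solution_J_red by blast
  define \<sigma> where "\<sigma> s t = c * (sinh (y + s) * (cosh (y - s) - cos (d - t)) - (cosh (y + s) - cos (d + t)) * sinh (y - s))" for s t
  have d\<sigma>: "((\<lambda>s. c * dist_sq y d s t) has_real_derivative \<sigma> s t) (at s)" for s t
    unfolding dist_sq_def \<sigma>_def by (auto intro!: derivative_eq_intros simp: algebra_simps)
  have pos: "c * dist_sq y d s t > 0" if "b < s" for s t
    using y that c by (intro mult_pos_pos dist_sq_pos) auto
  have posx: "c * dist_sq x e a t > 0" for t
    using x c by (intro mult_pos_pos dist_sq_pos) auto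
  have dY: "((\<lambda>s. Y_red (c * dist_sq y d s t)) has_real_derivative Y' (c * dist_sq y d s t) * \<sigma> s t) (at s)"
    if "b < s" for s t
    by (rule DERIV_chain'[OF d\<sigma>, THEN DERIV_cong]) (use Y' pos[OF that] in \<open>auto simp: bessel_solution_def\<close>)
  have contJ: "continuous_on {0<..} J_red" and contY: "continuous_on {0<..} Y_red" and contY': "continuous_on {0<..} Y'"
    using bessel_solution_continuous_on J' Y' by blast+
  have contJ1: "continuous_on X (\<lambda>z. J_red (c * dist_sq x e a (h z)))" if "continuous_on X h"
    for h and X :: "'z::t2_space set"
    by (rule continuous_on_compose2[OF contJ]) (use that posx in \<open>auto intro!: continuous_intros simp: dist_sq_def\<close>)
  have "((\<lambda>s. integral (cbox (- pi) pi) (\<lambda>t. J_red (c * dist_sq x e a t) * Y_red (c * dist_sq y d s t)))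
    has_real_derivative integral (cbox (- pi) pi) (\<lambda>t. J_red (c * dist_sq x e a t) * (Y' (c * dist_sq y d a t) * \<sigma> a t)))
    (at a within {b<..})"
  proof (rule leibniz_rule_field_derivative[where
        fx = "\<lambda>s t. J_red (c * dist_sq x e a t) * (Y' (c * dist_sq y d s t) * \<sigma> s t)"])
    show "((\<lambda>s. J_red (c * dist_sq x e a t) * Y_red (c * dist_sq y d s t)) has_real_derivative
        J_red (c * dist_sq x e a t) * (Y' (c * dist_sq y d s t) * \<sigma> s t)) (at s within {b<..})" if "s \<in> {b<..}" for s t
      by (rule has_field_derivative_at_within, rule DERIV_cmult, rule dY) (use that in simp)
    show "(\<lambda>t. J_red (c * dist_sq x e a t) * Y_red (c * dist_sq y d s t)) integrable_on cbox (- pi) pi" if "s \<in> {b<..}" for s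
    proof (intro integrable_continuous continuous_on_mult contJ1 continuous_on_id)
      show "continuous_on (cbox (- pi) pi) (\<lambda>t. Y_red (c * dist_sq y d s t))"
        by (rule continuous_on_compose2[OF contY]) (use that pos in \<open>auto intro!: continuous_intros simp: dist_sq_def\<close>)
    qed
    show "continuous_on ({b<..} \<times> cbox (- pi) pi)
       (\<lambda>(s, t). J_red (c * dist_sq x e a t) * (Y' (c * dist_sq y d s t) * \<sigma> s t))"
      unfolding case_prod_unfold
    proof (intro continuous_on_mult contJ1 continuous_on_snd continuous_on_id)
      show "continuous_on ({b<..} \<times> cbox (- pi) pi) (\<lambda>z. Y' (c * dist_sq y d (fst z) (snd z)))"
        by (rule continuous_on_compose2[OF contY']) (use pos in \<open>auto intro!: continuous_intros simp: dist_sq_def\<close>)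
      show "continuous_on ({b<..} \<times> cbox (- pi) pi) (\<lambda>z. \<sigma> (fst z) (snd z))"
        unfolding \<sigma>_def by (intro continuous_intros)
    qed
  qed (use b in auto)
  moreover have "J_red (c * dist_sq x e a t) * (Y' (c * dist_sq y d a t) * \<sigma> a t) = u_fun k x e a t * d3v k y d a t" for t
  proof -
    have "u_fun k x e a t = J_red (c * dist_sq x e a t)"
      using dist_sq_pos[OF x, of e t] by (simp add: u_fun_def bessel_J0_eq dist_elliptic power_mult_distrib c_def)
    moreover have "d3v k y d a t = Y' (c * dist_sq y d a t) * \<sigma> a t"
      unfolding d3v_def
    \<comment> \<open>\<open>bessel_Y0\<close> agrees with \<open>Y_red\<close> only at positive
      arguments, so the functions are compared on the open set \<open>s > b\<close> around
      \<open>a\<close>.\<close>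
    proof (rule DERIV_imp_deriv, rule has_field_derivative_transform_within_open[OF dY[OF b]])
      show "Y_red (c * dist_sq y d s t) = v_fun k y d s t" if "s \<in> {b<..}" for s
      proof -
        have "dist_sq y d s t > 0" using y that by (intro dist_sq_pos) auto
        then show ?thesis
          using k by (simp add: v_fun_def bessel_Y0_eq dist_elliptic power_mult_distrib c_def)
      qed
    qed (use b in auto)
    ultimately show ?thesis by simp
  qed
  ultimately show ?thesis
    using at_within_open[of a "{b<..}"] b unfolding I_int_def c_def[symmetric] by simp
qed

theorem theorem2p2:
  fixes k \<xi> \<xi>' \<xi>0 :: real
  assumes "k > 0"
    and "0 < \<xi>" and "\<xi> < \<xi>0"
    and "0 < \<xi>'" and "\<xi>' < \<xi>0"
  shows "\<forall>\<eta> \<eta>'. I_int k \<xi>0 \<xi> \<eta> \<xi>' \<eta>' = I_int k \<xi>0 \<xi>' \<eta>' \<xi> \<eta>"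
proof (intro allI)
  fix \<eta> \<eta>'
  define L where "L x e y d s = integral {- pi..pi}
    (\<lambda>t. J_red (k\<^sup>2 / 4 * dist_sq x e \<xi>0 t) * Y_red (k\<^sup>2 / 4 * dist_sq y d s t))" for x e y d s
  obtain b where b: "max \<xi> \<xi>' < b" "b < \<xi>0"
    using dense[of "max \<xi> \<xi>'" \<xi>0] assms by auto
  obtain J' Y' where "bessel_solution J_red J'" "bessel_solution Y_red Y'"
    using bessel_solution_J_red bessel_solution_Y_red by blast
  then have sym: "L \<xi> \<eta> \<xi>' \<eta>' s = L \<xi>' \<eta>' \<xi> \<eta> s" if "s \<in> {b<..}" for s
    unfolding L_def by (rule bessel_pairing_sym) (use assms b that in auto)
  have "(L \<xi> \<eta> \<xi>' \<eta>' has_real_derivative I_int k \<xi>0 \<xi> \<eta> \<xi>' \<eta>') (at \<xi>0)"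
    unfolding L_def by (rule I_int_has_derivative[where b = b]) (use assms b in auto)
  \<comment> \<open>Both functions of \<open>s\<close> agree on the neighbourhood
    \<open>{b<..}\<close> of \<open>\<xi>0\<close>, so they share the derivative there.\<close>
  then have "(L \<xi>' \<eta>' \<xi> \<eta> has_real_derivative I_int k \<xi>0 \<xi> \<eta> \<xi>' \<eta>') (at \<xi>0)"
    by (rule has_field_derivative_transform_within_open[where S = "{b<..}"]) (use sym b in auto)
  moreover have "(L \<xi>' \<eta>' \<xi> \<eta> has_real_derivative I_int k \<xi>0 \<xi>' \<eta>' \<xi> \<eta>) (at \<xi>0)"
    unfolding L_def by (rule I_int_has_derivative[where b = b]) (use assms b in auto)
  ultimately show "I_int k \<xi>0 \<xi> \<eta> \<xi>' \<eta>' = I_int k \<xi>0 \<xi>' \<eta>' \<xi> \<eta>"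
    by (rule DERIV_unique)
qed

end
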